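(* If each bus in $\mathcal{O}$ can be matched to two unique buses in $\mathcal{M}$ on $\mathcal{G}$ (that is, there are two injective maps $\mu_1,\mu_2:\mathcal{O}\to\mathcal{M}$ with disjoint images such that $\mu_1(n)$ and $\mu_2(n)$ are both adjacent to $n$ in $\mathcal{G}$ for every $n\in\mathcal{O}$), then the Jacobian matrix $\mathbf{J}(\mathbf{v}_1)$ related to single-slot probing ($T=1$) with non-phasor data has full generic rank.
   Context: Grid. A feeder is a finite graph $\mathcal{G}=(\mathcal{N}^+,\mathcal{L})$ with bus set $\mathcal{N}^+=\{0,\dots,N\}$ and line set $\mathcal{L}$. Its bus admittance matrix is $\mathbf{Y}=\mathbf{G}+j\mathbf{B}$ with $\mathbf{G},\mathbf{B}$ real; for $n\ne m$ the entries $G_{nm},B_{nm}$ are non-zero only on lines, and the sparsity pattern of $\mathbf{G}$ is taken to be: $G_{nm}\neq 0$ iff $n=m$ or $(n,m)\in\mathcal{L}$. The buses are partitioned as $\mathcal{N}^+=\mathcal{M}\cup\mathcal{O}$ (disjoint), $\mathcal{M}$ being the metered (probed) and $\mathcal{O}$ the non-metered buses; $M=|\mathcal{M}|$, $O=|\mathcal{O}|$, $N+1=M+O$. State and power flow functions. With voltage phasors $v_n=v_{r,n}+jv_{i,n}$, the state is $\mathbf{v}=[v_{r,0},\dots,v_{r,N},v_{i,0},\dots,v_{i,N}]^\top\in\mathbb{R}^{2(N+1)}$. As functions of $\mathbf{v}$: the squared voltage magnitude $u_n(\mathbf{v})=v_{r,n}^2+v_{i,n}^2$ and the power injections $p_n(\mathbf{v})=v_{r,n}\sum_m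 (v_{r,m}G_{nm}-v_{i,m}B_{nm})+v_{i,n}\sum_m (v_{r,m}B_{nm}+v_{i,m}G_{nm})$, $q_n(\mathbf{v})=v_{i,n}\sum_m (v_{r,m}G_{nm}-v_{i,m}B_{nm})-v_{r,n}\sum_m (v_{r,m}B_{nm}+v_{i,m}G_{nm})$. Single-slot probing with non-phasor data. The unknown is one state $\mathbf{v}_1$; the equations prescribe $u_n(\mathbf{v}_1),p_n(\mathbf{v}_1),q_n(\mathbf{v}_1)$ for all $n\in\mathcal{M}$ (there are no coupling equations). $\mathbf{J}(\mathbf{v}_1)$ is the $3M\times 2(N+1)$ Jacobian of these equations. Its sparsity pattern: the gradient row of $u_n$ has the pattern of row $n$ of $[\mathbf{I}_{N+1}~\mathbf{I}_{N+1}]$, and the gradient row of $p_n$ or of $q_n$ has the pattern of row $n$ of $[\mathbf{G}~\mathbf{G}]$. Generic rank. The generic rank of a matrix is the maximum rank attained when its non-zero entries (the entries in its sparsity pattern) are allowed to take arbitrary real values, independently. A matrix with at least as many rows as columns has full generic rank if its generic rank equals its number of columns. *)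

theory Defs
  imports "HOL-Analysis.Derivative" "Jordan_Normal_Form.DL_Rank"
begin

definition support :: "'a::zero mat \<Rightarrow> (nat \<times> nat) set" where
  "support A = {(i, j). i < dim_row A \<and> j < dim_col A \<and> A $$ (i, j) \<noteq> 0}"

text \<open>The entries of \<^term>\<open>A\<close> at the positions in \<^term>\<open>S\<close> are free, all others keep their value.
  When \<^term>\<open>S\<close> is a sparsity pattern of \<^term>\<open>A\<close>, the kept values are zeros; see
  \<open>realizations_eq\<close>.\<close>

definition realizations :: "real mat \<Rightarrow> (nat \<times> nat) set \<Rightarrow> real mat set" where
  "realizations A S = {R \<in> carrier_mat (dim_row A) (dim_col A).
     \<forall>i < dim_row A. \<forall>j < dim_col A. (i, j) \<notin> S \<longrightarrow> R $$ (i, j) = A $$ (i, j)}"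

definition generic_rank :: "real mat \<Rightarrow> (nat \<times> nat) set \<Rightarrow> nat" where
  "generic_rank A S = Max (vec_space.rank (dim_row A) ` realizations A S)"

definition full_generic_rank :: "real mat \<Rightarrow> (nat \<times> nat) set \<Rightarrow> bool" where
  "full_generic_rank A S \<longleftrightarrow> dim_col A \<le> dim_row A \<and> generic_rank A S = dim_col A"

lemma realizations_eq:
  assumes "support A \<subseteq> S"
  shows "realizations A S = {R \<in> carrier_mat (dim_row A) (dim_col A). support R \<subseteq> S}"
  using assms unfolding realizations_def support_def by fastforce

lemma rank_realizations_le:
  assumes "R \<in> realizations A S"
  shows "vec_space.rank (dim_row A) R \<le> dim_col A"
  using assms vec_space.rank_le_nc unfolding realizations_def by blast

text \<open>Buses are \<open>0, \<dots>, N\<close>; a line is the two-element set of its end buses. \<^term>\<open>Y\<close> is the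
  bus admittance matrix \<open>G + j B\<close>.\<close>

definition feeder :: "nat \<Rightarrow> nat set set \<Rightarrow> complex mat \<Rightarrow> bool" where
  "feeder N L Y \<longleftrightarrow>
     L \<subseteq> {e. e \<subseteq> {0..N} \<and> card e = 2} \<and>
     Y \<in> carrier_mat (N + 1) (N + 1) \<and>
     (\<forall>n\<le>N. \<forall>m\<le>N. n \<noteq> m \<longrightarrow> {n, m} \<notin> L \<longrightarrow> Y $$ (n, m) = 0) \<and>
     (\<forall>n\<le>N. \<forall>m\<le>N. Re (Y $$ (n, m)) \<noteq> 0 \<longleftrightarrow> n = m \<or> {n, m} \<in> L)"

abbreviation conductance :: "complex mat \<Rightarrow> real mat" where
  "conductance Y \<equiv> map_mat Re Y"

abbreviation susceptance :: "complex mat \<Rightarrow> real mat" where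
  "susceptance Y \<equiv> map_mat Im Y"

text \<open>The state \<^term>\<open>v\<close> is a vector of dimension \<open>2 (N + 1)\<close>: the real parts of the voltage
  phasors of the buses \<open>0, \<dots>, N\<close> followed by the imaginary parts.\<close>

definition vr :: "real vec \<Rightarrow> nat \<Rightarrow> real" where
  "vr v n = v $ n"

definition vi :: "nat \<Rightarrow> real vec \<Rightarrow> nat \<Rightarrow> real" where
  "vi N v n = v $ (N + 1 + n)"

definition sq_voltage :: "nat \<Rightarrow> nat \<Rightarrow> real vec \<Rightarrow> real" where
  "sq_voltage N n v = (vr v n)\<^sup>2 + (vi N v n)\<^sup>2"

definition active_power :: "nat \<Rightarrow> complex mat \<Rightarrow> nat \<Rightarrow> real vec \<Rightarrow> real" where
  "active_power N Y n v = (let G = conductance Y; B = susceptance Y in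
     vr v n * (\<Sum>m = 0..N. vr v m * G $$ (n, m) - vi N v m * B $$ (n, m)) +
     vi N v n * (\<Sum>m = 0..N. vr v m * B $$ (n, m) + vi N v m * G $$ (n, m)))"

definition reactive_power :: "nat \<Rightarrow> complex mat \<Rightarrow> nat \<Rightarrow> real vec \<Rightarrow> real" where
  "reactive_power N Y n v = (let G = conductance Y; B = susceptance Y in
     vi N v n * (\<Sum>m = 0..N. vr v m * G $$ (n, m) - vi N v m * B $$ (n, m)) -
     vr v n * (\<Sum>m = 0..N. vr v m * B $$ (n, m) + vi N v m * G $$ (n, m)))"

definition partial_deriv :: "nat \<Rightarrow> (real vec \<Rightarrow> real) \<Rightarrow> real vec \<Rightarrow> real" where
  "partial_deriv k f v = deriv (\<lambda>t. f (v + t \<cdot>\<^sub>v unit_vec (dim_vec v) k)) 0"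

definition jacobian :: "(real vec \<Rightarrow> real) list \<Rightarrow> real vec \<Rightarrow> real mat" where
  "jacobian fs v = mat (length fs) (dim_vec v) (\<lambda>(i, k). partial_deriv k (fs ! i) v)"

text \<open>The left-hand sides of the equations at the metered buses \<^term>\<open>Mt\<close>.\<close>

definition probing_functions :: "nat \<Rightarrow> complex mat \<Rightarrow> nat set \<Rightarrow> (real vec \<Rightarrow> real) list" where
  "probing_functions N Y Mt = (let ms = sorted_list_of_set Mt in
     map (sq_voltage N) ms @ map (active_power N Y) ms @ map (reactive_power N Y) ms)"

definition probing_jacobian :: "nat \<Rightarrow> complex mat \<Rightarrow> nat set \<Rightarrow> real vec \<Rightarrow> real mat" where
  "probing_jacobian N Y Mt v = jacobian (probing_functions N Y Mt) v"

text \<open>The pattern is structural and does not depend on the state: it consists of the non-zero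
  positions of the rows of \<open>[I I]\<close> and, twice, of \<open>[G G]\<close> that belong to metered buses. At particular
  states the Jacobian may vanish at some of them; it always vanishes elsewhere, see
  \<open>support_probing_jacobian\<close>.\<close>

definition probing_pattern :: "nat \<Rightarrow> complex mat \<Rightarrow> nat set \<Rightarrow> (nat \<times> nat) set" where
  "probing_pattern N Y Mt =
    (let ms = sorted_list_of_set Mt;
         dup = (\<lambda>A n. row A n @\<^sub>v row A n);
         I = 1\<^sub>m (N + 1);
         G = conductance Y
     in support (mat_of_rows (2 * (N + 1)) (map (dup I) ms @ map (dup G) ms @ map (dup G) ms)))"

text \<open>Explicit partial derivatives: \<^term>\<open>k\<close> is a state coordinate, so \<open>e n\<close> and \<open>f n\<close> are the
  derivatives of \<open>vr v n\<close> and \<open>vi N v n\<close> along it.\<close>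

lemma power_derivs:
  fixes N k n :: nat and v :: "real vec" and Y :: "complex mat"
  assumes v: "v \<in> carrier_vec (2 * (N + 1))" and n: "n \<le> N"
  defines "e \<equiv> (\<lambda>m::nat. if k = m then 1 else 0 :: real)"
    and "f \<equiv> (\<lambda>m::nat. if k = N + 1 + m then 1 else 0 :: real)"
    and "G \<equiv> conductance Y" and "B \<equiv> susceptance Y"
  shows "partial_deriv k (sq_voltage N n) v = 2 * vr v n * e n + 2 * vi N v n * f n"
    and "partial_deriv k (active_power N Y n) v =
      e n * (\<Sum>m = 0..N. vr v m * G $$ (n, m) - vi N v m * B $$ (n, m)) +
      vr v n * (\<Sum>m = 0..N. e m * G $$ (n, m) - f m * B $$ (n, m)) +
      f n * (\<Sum>m = 0..N. vr v m * B $$ (n, m) + vi N v m * G $$ (n, m)) +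
      vi N v n * (\<Sum>m = 0..N. e m * B $$ (n, m) + f m * G $$ (n, m))" (is ?P)
    and "partial_deriv k (reactive_power N Y n) v =
      f n * (\<Sum>m = 0..N. vr v m * G $$ (n, m) - vi N v m * B $$ (n, m)) +
      vi N v n * (\<Sum>m = 0..N. e m * G $$ (n, m) - f m * B $$ (n, m)) -
      e n * (\<Sum>m = 0..N. vr v m * B $$ (n, m) + vi N v m * G $$ (n, m)) -
      vr v n * (\<Sum>m = 0..N. e m * B $$ (n, m) + f m * G $$ (n, m))" (is ?Q)
proof -
  let ?w = "\<lambda>t. v + t \<cdot>\<^sub>v unit_vec (dim_vec v) k"
  have r: "vr (?w t) m = vr v m + t * e m" if "m \<le> N" for t m
    using v that by (auto simp: vr_def e_def unit_vec_def)
  have i: "vi N (?w t) m = vi N v m + t * f m" if "m \<le> N" for t m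
    using v that by (auto simp: vi_def f_def unit_vec_def)
  have u: "sq_voltage N n (?w t) = (vr v n + t * e n)\<^sup>2 + (vi N v n + t * f n)\<^sup>2" for t
    by (simp only: sq_voltage_def r[OF n] i[OF n])
  show "partial_deriv k (sq_voltage N n) v = 2 * vr v n * e n + 2 * vi N v n * f n"
    unfolding partial_deriv_def u
    by (rule DERIV_imp_deriv) (auto intro!: derivative_eq_intros)
  have s1: "(\<Sum>m = 0..N. vr (?w t) m * a m - vi N (?w t) m * b m) =
      (\<Sum>m = 0..N. (vr v m + t * e m) * a m - (vi N v m + t * f m) * b m)" for t a b
    by (rule sum.cong) (simp_all add: r i)
  have s2: "(\<Sum>m = 0..N. vr (?w t) m * a m + vi N (?w t) m * b m) =
      (\<Sum>m = 0..N. (vr v m + t * e m) * a m + (vi N v m + t * f m) * b m)" for t a b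
    by (rule sum.cong) (simp_all add: r i)
  show ?P
    unfolding partial_deriv_def active_power_def Let_def r[OF n] i[OF n] s1 s2 G_def[symmetric] B_def[symmetric]
    by (rule DERIV_imp_deriv) (auto intro!: derivative_eq_intros simp: algebra_simps)
  show ?Q
    unfolding partial_deriv_def reactive_power_def Let_def r[OF n] i[OF n] s1 s2 G_def[symmetric] B_def[symmetric]
    by (rule DERIV_imp_deriv) (auto intro!: derivative_eq_intros simp: algebra_simps)
qed

lemma support_probing_jacobian:
  assumes grid: "feeder N L Y" and Mt: "Mt \<subseteq> {0..N}" and v: "v \<in> carrier_vec (2 * (N + 1))"
  shows "support (probing_jacobian N Y Mt v) \<subseteq> probing_pattern N Y Mt"
proof -
  define ms where "ms = sorted_list_of_set Mt"
  define dup where "dup = (\<lambda>A n. row A n @\<^sub>v row A n :: real vec)"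
  define I where "I = (1\<^sub>m (N + 1) :: real mat)"
  define G where "G = conductance Y"
  have "finite Mt" using Mt finite_subset by blast
  then have ms: "n \<le> N" if "n \<in> set ms" for n using Mt that unfolding ms_def by auto
  have Y: "dim_row Y = N + 1" "dim_col Y = N + 1" using grid by (auto simp: feeder_def)
  have Y0: "Re (Y $$ (n, m)) = 0 \<Longrightarrow> Y $$ (n, m) = 0 \<and> n \<noteq> m" if "n \<le> N" "m \<le> N" for n m
    using grid that unfolding feeder_def by blast
  have Bz: "G $$ (n, m) = 0 \<Longrightarrow> susceptance Y $$ (n, m) = 0 \<and> n \<noteq> m" if "n \<le> N" "m \<le> N" for n m
    using Y0[OF that] Y that by (simp add: G_def)
  have u: "dup I n $ k \<noteq> 0" if "partial_deriv k (sq_voltage N n) v \<noteq> 0" "n \<le> N" "k < 2 * (N + 1)" for n k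
    using that(1) that(2,3) unfolding power_derivs(1)[OF v that(2)]
    by (auto simp: dup_def I_def split: if_splits)
  have z: "(if k = n then 1 else 0 :: real) = 0 \<and> (if k = N + 1 + n then 1 else 0 :: real) = 0 \<and>
      (\<forall>m\<le>N. (k = m \<or> k = N + 1 + m) \<longrightarrow> G $$ (n, m) = 0 \<and> susceptance Y $$ (n, m) = 0)"
    if d: "dup G n $ k = 0" and n: "n \<le> N" and k: "k < 2 * (N + 1)" for n k
  proof -
    have "G $$ (n, m) = 0" if "m \<le> N" "k = m \<or> k = N + 1 + m" for m
      using d n that Y by (auto simp: dup_def G_def)
    then show ?thesis using Bz[OF n] n by fastforce
  qed
  have zs: "(\<Sum>m = 0..N. (if k = m then 1 else 0 :: real) * a m + (if k = N + 1 + m then 1 else 0) * b m) = 0"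
    "(\<Sum>m = 0..N. (if k = m then 1 else 0 :: real) * a m - (if k = N + 1 + m then 1 else 0) * b m) = 0"
    if "\<forall>m\<le>N. (k = m \<or> k = N + 1 + m) \<longrightarrow> a m = 0 \<and> b m = 0" for k a b
    by (rule sum.neutral, use that in auto)+
  have pq: "dup G n $ k \<noteq> 0"
    if "partial_deriv k (active_power N Y n) v \<noteq> 0 \<or> partial_deriv k (reactive_power N Y n) v \<noteq> 0"
      and n: "n \<le> N" and k: "k < 2 * (N + 1)" for n k
  proof
    assume d: "dup G n $ k = 0"
    note z = z[OF d n k]
    have z1: "\<forall>m\<le>N. (k = m \<or> k = N + 1 + m) \<longrightarrow> G $$ (n, m) = 0 \<and> susceptance Y $$ (n, m) = 0"
      and z2: "\<forall>m\<le>N. (k = m \<or> k = N + 1 + m) \<longrightarrow> susceptance Y $$ (n, m) = 0 \<and> G $$ (n, m) = 0"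
      using z by blast+
    have "partial_deriv k (active_power N Y n) v = 0" "partial_deriv k (reactive_power N Y n) v = 0"
      unfolding power_derivs(2,3)[OF v n] G_def[symmetric] zs(2)[OF z1] zs(1)[OF z2]
      using z by simp_all
    then show False using that(1) by simp
  qed
  have dims: "dim_vec v = 2 * (N + 1)" using v by simp
  show ?thesis
    unfolding probing_jacobian_def jacobian_def probing_pattern_def Let_def probing_functions_def
      support_def ms_def[symmetric] G_def[symmetric] I_def[symmetric] dup_def[symmetric] dims
    using u pq ms by (auto simp: nth_append mat_of_rows_index split: if_splits)
qed

end

theory Submission
  imports Defs
begin

text \<open>A matching of all columns into rows inside the sparsity pattern gives a realization whose
  columns are distinct unit vectors. For the probing Jacobian, the two columns of a metered bus
  \<open>m\<close> are matched to its \<open>u\<close> and \<open>q\<close> equations, and the two columns of a non-metered bus \<open>n\<close>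
  to the \<open>p\<close> equations of \<open>\<mu>\<^sub>1 n\<close> and \<open>\<mu>\<^sub>2 n\<close>.\<close>

lemma rank_partial_permutation_mat:
  assumes inj: "inj_on s {..<nc}" and ran: "s ` {..<nc} \<subseteq> {..<nr}"
  shows "vec_space.rank nr (mat nr nc (\<lambda>(i, j). if i = s j then 1 else 0 :: real)) = nc"
proof -
  interpret vec_space "TYPE(real)" nr .
  let ?R = "mat nr nc (\<lambda>(i, j). if i = s j then 1 else 0 :: real)"
  have cols: "cols ?R = map (\<lambda>j. unit_vec nr (s j)) [0..<nc]"
    using ran by (intro nth_equalityI) (auto simp: image_subset_iff)
  \<comment> \<open>Independence is a property of the set of columns and would not notice
    repetitions; injectivity of \<open>s\<close> excludes them, so all \<open>nc\<close> columns
    count towards the rank.\<close>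
  have "inj_on (\<lambda>j. unit_vec nr (s j) :: real vec) {..<nc}"
    using inj ran by (auto simp: inj_on_def image_subset_iff)
  then have "distinct (cols ?R)"
    unfolding cols distinct_map by (simp add: atLeast0LessThan)
  moreover have "set (cols ?R) \<subseteq> set (unit_vecs nr)"
    using ran unfolding cols unit_vecs_def by (auto simp: image_subset_iff)
  then have "lin_indpt (set (cols ?R))"
    using unit_vecs_basis supset_ld_is_ld unfolding basis_def by blast
  ultimately show ?thesis
    by (intro lin_indpt_full_rank) auto
qed

text \<open>Since \<open>S\<close> covers the support of \<open>A\<close>, all fixed entries are
  zero, so the 0/1 matrix of the matching \<open>s\<close> is itself a realization. Its rank meets
  the upper bound given by the number of columns.\<close>

lemma full_generic_rankI:
  assumes supp: "support A \<subseteq> S"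
    and inj: "inj_on s {..<dim_col A}" and ran: "s ` {..<dim_col A} \<subseteq> {..<dim_row A}"
    and pat: "\<And>j. j < dim_col A \<Longrightarrow> (s j, j) \<in> S"
  shows "full_generic_rank A S"
proof -
  let ?R = "mat (dim_row A) (dim_col A) (\<lambda>(i, j). if i = s j then 1 else 0 :: real)"
  let ?ranks = "vec_space.rank (dim_row A) ` realizations A S"
  have "?R \<in> realizations A S"
    unfolding realizations_eq[OF supp] using pat by (auto simp: support_def split: if_splits)
  then have mem: "dim_col A \<in> ?ranks"
    using rank_partial_permutation_mat[OF inj ran] by force
  have le: "r \<le> dim_col A" if "r \<in> ?ranks" for r
    using that rank_realizations_le by auto
  \<comment> \<open>There may be infinitely many realizations, but their ranks are bounded, so the
    \<open>Max\<close> in \<open>generic_rank\<close> is a genuine maximum.\<close>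
  then have "finite ?ranks"
    by (meson finite_nat_set_iff_bounded_le)
  then have "generic_rank A S = dim_col A"
    unfolding generic_rank_def using mem le by (intro Max_eqI) auto
  moreover have "dim_col A \<le> dim_row A"
    using card_inj_on_le[OF inj ran] by simp
  ultimately show ?thesis
    by (simp add: full_generic_rank_def)
qed

text \<open>The rows form three blocks of length \<open>card Mt\<close>, for u, p and q, each
  listing the metered buses in increasing order. A u row comes from \<open>[I I]\<close> and reaches
  only its own bus; p and q rows come from \<open>[G G]\<close> and also reach the
  neighbours.\<close>

lemma probing_patternI:
  fixes Mt :: "nat set"
  defines "ms \<equiv> sorted_list_of_set Mt"
  assumes grid: "feeder N L Y" and Mt: "Mt \<subseteq> {0..N}" and k: "k < card Mt" and n: "n \<le> N"
    and j: "j = n \<or> j = N + 1 + n"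
  shows "ms ! k = n \<Longrightarrow> (k, j) \<in> probing_pattern N Y Mt"
    and "ms ! k = n \<or> {ms ! k, n} \<in> L \<Longrightarrow> (card Mt + k, j) \<in> probing_pattern N Y Mt"
    and "ms ! k = n \<or> {ms ! k, n} \<in> L \<Longrightarrow> (2 * card Mt + k, j) \<in> probing_pattern N Y Mt"
proof -
  have fin: "finite Mt"
    using Mt finite_subset by blast
  have len: "length ms = card Mt"
    by (simp add: ms_def)
  have "ms ! k \<in> set ms"
    using k len by simp
  then have le: "ms ! k \<le> N"
    using fin Mt by (auto simp: ms_def)
  have Y: "dim_row Y = N + 1" "dim_col Y = N + 1"
    using grid by (auto simp: feeder_def)
  have Re: "Re (Y $$ (ms ! k, n)) \<noteq> 0" if "ms ! k = n \<or> {ms ! k, n} \<in> L"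
    using grid that le n unfolding feeder_def by blast
  note unf = probing_pattern_def Let_def support_def ms_def[symmetric]
  show "(k, j) \<in> probing_pattern N Y Mt" if "ms ! k = n"
    using that j k n Y len unfolding unf by (auto simp: mat_of_rows_index nth_append)
  show "(card Mt + k, j) \<in> probing_pattern N Y Mt" if "ms ! k = n \<or> {ms ! k, n} \<in> L"
    using Re[OF that] j k n le Y len unfolding unf by (auto simp: mat_of_rows_index nth_append)
  show "(2 * card Mt + k, j) \<in> probing_pattern N Y Mt" if "ms ! k = n \<or> {ms ! k, n} \<in> L"
    using Re[OF that] j k n le Y len unfolding unf by (auto simp: mat_of_rows_index nth_append)
qed

theorem theorem4:
  fixes N :: nat and L :: "nat set set" and Y :: "complex mat"
    and Mt Ob :: "nat set" and v\<^sub>1 :: "real vec" and \<mu>\<^sub>1 \<mu>\<^sub>2 :: "nat \<Rightarrow> nat"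
  assumes grid: "feeder N L Y"
    and partition: "Mt \<union> Ob = {0..N}" "Mt \<inter> Ob = {}"
    and maps: "\<mu>\<^sub>1 ` Ob \<subseteq> Mt" "\<mu>\<^sub>2 ` Ob \<subseteq> Mt"
    and inj: "inj_on \<mu>\<^sub>1 Ob" "inj_on \<mu>\<^sub>2 Ob"
    and disj: "\<mu>\<^sub>1 ` Ob \<inter> \<mu>\<^sub>2 ` Ob = {}"
    and adj: "\<And>n. n \<in> Ob \<Longrightarrow> {n, \<mu>\<^sub>1 n} \<in> L \<and> {n, \<mu>\<^sub>2 n} \<in> L"
    and state: "v\<^sub>1 \<in> carrier_vec (2 * (N + 1))"
  shows "full_generic_rank (probing_jacobian N Y Mt v\<^sub>1) (probing_pattern N Y Mt)"
proof -
  define ms where "ms = sorted_list_of_set Mt"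
  define M where "M = card Mt"
  have Mt: "Mt \<subseteq> {0..N}"
    using partition by blast
  then have fin: "finite Mt"
    using finite_subset by blast
  have dims: "dim_row (probing_jacobian N Y Mt v\<^sub>1) = 3 * M"
    "dim_col (probing_jacobian N Y Mt v\<^sub>1) = 2 * (N + 1)"
    using state by (simp_all add: probing_jacobian_def jacobian_def probing_functions_def Let_def M_def)
  have "\<forall>m\<in>Mt. \<exists>k<M. ms ! k = m"
    using fin by (simp add: ms_def M_def flip: in_set_conv_nth)
      (metis in_set_conv_nth length_sorted_list_of_set set_sorted_list_of_set)
  \<comment> \<open>\<open>pos\<close> inverts the enumeration \<open>ms\<close>: it is the offset
    of a metered bus within each row block.\<close>
  then obtain pos where pos: "\<And>m. m \<in> Mt \<Longrightarrow> pos m < M" "\<And>m. m \<in> Mt \<Longrightarrow> ms ! pos m = m"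
    by metis
  have pos_eq: "pos m = pos m' \<longleftrightarrow> m = m'" if "m \<in> Mt" "m' \<in> Mt" for m m'
    using pos that by metis
  \<comment> \<open>Metered buses use only the u and q blocks, which leaves the whole p block,
    starting at row \<open>M\<close>, to the non-metered ones.\<close>
  define s where "s = (\<lambda>j. if j \<le> N then if j \<in> Mt then pos j else M + pos (\<mu>\<^sub>1 j)
     else if j - (N + 1) \<in> Mt then 2 * M + pos (j - (N + 1)) else M + pos (\<mu>\<^sub>2 (j - (N + 1))))"
  have s_simps: "m \<in> Mt \<Longrightarrow> s m = pos m" "m \<in> Mt \<Longrightarrow> s (N + 1 + m) = 2 * M + pos m"
    "m \<in> Ob \<Longrightarrow> s m = M + pos (\<mu>\<^sub>1 m)" "m \<in> Ob \<Longrightarrow> s (N + 1 + m) = M + pos (\<mu>\<^sub>2 m)" for m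
    using partition by (auto simp: s_def)
  have le: "m \<le> N" if "m \<in> Mt \<or> m \<in> Ob" for m
    using partition(1) that by auto
  have mu: "\<mu>\<^sub>1 m \<in> Mt" "\<mu>\<^sub>2 m \<in> Mt" if "m \<in> Ob" for m
    using maps that by auto
  have mu_neq: "\<mu>\<^sub>1 m \<noteq> \<mu>\<^sub>2 m'" if "m \<in> Ob" "m' \<in> Ob" for m m'
    using disj that by blast
  \<comment> \<open>The bounds by \<open>M\<close> are recorded in each case because they keep the
    three row blocks apart.\<close>
  have cases: "(\<exists>m\<in>Mt. j = m \<and> s j = pos m \<and> pos m < M) \<or>
      (\<exists>m\<in>Mt. j = N + 1 + m \<and> s j = 2 * M + pos m \<and> pos m < M) \<or>
      (\<exists>m\<in>Ob. j = m \<and> s j = M + pos (\<mu>\<^sub>1 m) \<and> pos (\<mu>\<^sub>1 m) < M) \<or>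
      (\<exists>m\<in>Ob. j = N + 1 + m \<and> s j = M + pos (\<mu>\<^sub>2 m) \<and> pos (\<mu>\<^sub>2 m) < M)"
    if j: "j < 2 * (N + 1)" for j
  proof -
    have "\<exists>m\<le>N. j = m \<or> j = N + 1 + m"
      using j by presburger
    then obtain m where m: "m \<le> N" "j = m \<or> j = N + 1 + m"
      by blast
    then have "m \<in> Mt \<or> m \<in> Ob"
      using partition(1) by auto
    then show ?thesis
      using m(2) s_simps[of m] pos(1)[of m] pos(1)[OF mu(1), of m] pos(1)[OF mu(2), of m] by metis
  qed
  show ?thesis
  proof (rule full_generic_rankI[of _ _ s], unfold dims)
    show "support (probing_jacobian N Y Mt v\<^sub>1) \<subseteq> probing_pattern N Y Mt"
      by (rule support_probing_jacobian[OF grid Mt state])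
    show "s ` {..<2 * (N + 1)} \<subseteq> {..<3 * M}"
    proof clarify
      fix j assume "j < 2 * (N + 1)"
      then show "s j < 3 * M"
        using cases[of j] by auto
    qed
    show "inj_on s {..<2 * (N + 1)}"
    proof (rule inj_onI)
      fix i j assume ij: "i \<in> {..<2 * (N + 1)}" "j \<in> {..<2 * (N + 1)}" and eq: "s i = s j"
      have "i < 2 * (N + 1)" "j < 2 * (N + 1)"
        using ij by auto
      \<comment> \<open>Of the sixteen combinations, those in different blocks contradict the
        bounds. Within the p block, equal rows for the same map give equal buses by injectivity, and
        rows for different maps differ because the images are disjoint.\<close>
      from cases[OF this(1)] cases[OF this(2)] eq show "i = j"
        by (elim disjE bexE conjE)
          (simp_all add: pos_eq mu mu_neq mu_neq[symmetric] inj_on_eq_iff[OF inj(1)]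
            inj_on_eq_iff[OF inj(2)])
    qed
    show "(s j, j) \<in> probing_pattern N Y Mt" if "j < 2 * (N + 1)" for j
      using cases[OF that]
    proof (elim disjE bexE conjE)
      fix m assume "m \<in> Mt" "j = m" "s j = pos m"
      then show ?thesis
        using probing_patternI(1)[OF grid Mt, of "pos m" m j] pos le by (simp add: ms_def M_def)
    next
      fix m assume "m \<in> Mt" "j = N + 1 + m" "s j = 2 * M + pos m"
      then show ?thesis
        using probing_patternI(3)[OF grid Mt, of "pos m" m j] pos le by (simp add: ms_def M_def)
    next
      \<comment> \<open>The row belongs to the neighbour \<open>\<mu>\<^sub>1 m\<close>, the column
        to \<open>m\<close>: the entry is free because the two buses share a line.\<close>
      fix m assume "m \<in> Ob" "j = m" "s j = M + pos (\<mu>\<^sub>1 m)"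
      then show ?thesis
        using probing_patternI(2)[OF grid Mt, of "pos (\<mu>\<^sub>1 m)" m j] pos mu le adj[of m]
        by (simp add: ms_def M_def insert_commute)
    next
      fix m assume "m \<in> Ob" "j = N + 1 + m" "s j = M + pos (\<mu>\<^sub>2 m)"
      then show ?thesis
        using probing_patternI(2)[OF grid Mt, of "pos (\<mu>\<^sub>2 m)" m j] pos mu le adj[of m]
        by (simp add: ms_def M_def insert_commute)
    qed
  qed
qed

end
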